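(* Let $X$ and $R$ be finite sets with $R$ nonempty, let $Q_{ij}\in\mathbb R$ for $i\in X$, $j\in R\cup X$ be given by $Q_{ij}=\rho d_{ij}-(1-\rho)L_j$, and for every $S\subseteq X$ define $$f(S)=\sum_{i\in X}\min\Big\{\min_{j\in R}Q_{ij},\ \min_{j\in S}Q_{ij}\Big\}.$$ Then the set function $-f$ on subsets of $X$ is submodular; that is, for all $S\subseteq T\subseteq X$ and all $x\in X$ with $x\notin S$ and $x\notin T$, $$-f(S\cup\{x\})-(-f(S))\ \ge\ -f(T\cup\{x\})-(-f(T)).$$
   Context: $X$ is the set of incoming frames and $R$ the set of already selected frames. $d_{ij}\in\mathbb R$ is a pairwise dissimilarity between $i\in X$ and $j\in R\cup X$, $L_j\in\mathbb R$ is a pointwise loss of $j\in R\cup X$, and $\rho\in[0,1]$ is a fixed weight. The minimum over the empty set is taken to be $+\infty$, so that $f(\emptyset)=\sum_{i\in X}\min_{j\in R}Q_{ij}$. *)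

theory Defs
  imports "HOL-Library.Extended_Real"
begin

definition pair_cost :: "real \<Rightarrow> ('a \<Rightarrow> 'a \<Rightarrow> real) \<Rightarrow> ('a \<Rightarrow> real) \<Rightarrow> 'a \<Rightarrow> 'a \<Rightarrow> real"
  where "pair_cost \<rho> d L i j = \<rho> * d i j - (1 - \<rho>) * L j"

(* Min is unspecified on the empty set, hence the case split: the minimum over {} is +infinity. *)
definition min_over :: "('a \<Rightarrow> real) \<Rightarrow> 'a set \<Rightarrow> ereal"
  where "min_over q S = (if S = {} then \<infinity> else ereal (Min (q ` S)))"

(* Only used for nonempty R, where every summand is finite (ereal_selection_cost), so that
   real_of_ereal merely changes the type. *)
definition selection_cost :: "('a \<Rightarrow> 'a \<Rightarrow> real) \<Rightarrow> 'a set \<Rightarrow> 'a set \<Rightarrow> 'a set \<Rightarrow> real"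
  where "selection_cost Q X R S =
    (\<Sum>i\<in>X. real_of_ereal (min (min_over (Q i) R) (min_over (Q i) S)))"

definition submodular_on :: "'a set \<Rightarrow> ('a set \<Rightarrow> real) \<Rightarrow> bool"
  where "submodular_on V g \<longleftrightarrow>
    (\<forall>S T x. S \<subseteq> T \<and> T \<subseteq> V \<and> x \<in> V \<and> x \<notin> S \<and> x \<notin> T \<longrightarrow>
      g (S \<union> {x}) - g S \<ge> g (T \<union> {x}) - g T)"

lemma ereal_selection_cost:
  assumes "R \<noteq> {}"
  shows "ereal (selection_cost Q X R S) =
    (\<Sum>i\<in>X. min (min_over (Q i) R) (min_over (Q i) S))"
proof -
  have "ereal (real_of_ereal (min (min_over (Q i) R) (min_over (Q i) S)))
      = min (min_over (Q i) R) (min_over (Q i) S)" for i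
    using assms by (auto simp: min_over_def min_def)
  then show ?thesis
    by (simp add: selection_cost_def flip: sum_ereal)
qed

lemma selection_cost_empty:
  assumes "R \<noteq> {}"
  shows "selection_cost Q X R {} = (\<Sum>i\<in>X. Min (Q i ` R))"
  using assms by (simp add: selection_cost_def min_over_def)

end

(* Adding x lowers the summand m = Min (Q i ` (R \<union> S)) to min (Q i x) m, a drop of max 0 (m - Q i x).
   This drop increases with m, and m decreases as S grows. *)
theory Submission
  imports Defs
begin

text \<open>Since \<open>R\<close> is nonempty, \<open>selection_cost_eq_sum_Min\<close> turns the
  cost into a sum of real minima over \<open>R \<union> S\<close>, with no separate case for empty
  \<open>S\<close> because infinity is neutral for \<open>min\<close>. A sum inherits the inequality
  from its summands, so \<open>Min_image_insert_diff_mono\<close> settles one \<open>i\<close> at a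
  time; negation then reverses it.\<close>

lemma min_over_Un:
  assumes "finite A" and "finite B"
  shows "min_over q (A \<union> B) = min (min_over q A) (min_over q B)"
  using assms by (auto simp: min_over_def image_Un Min_Un ereal_min)

lemma selection_cost_eq_sum_Min:
  assumes "finite R" and "R \<noteq> {}" and "finite S"
  shows "selection_cost Q X R S = (\<Sum>i\<in>X. Min (Q i ` (R \<union> S)))"
proof -
  have "min (min_over q R) (min_over q S) = ereal (Min (q ` (R \<union> S)))" for q :: "'a \<Rightarrow> real"
    using assms by (subst min_over_Un [symmetric]) (auto simp: min_over_def)
  then show ?thesis
    by (simp add: selection_cost_def)
qed

text \<open>With \<open>c = q x\<close>, the change is \<open>min c m - m = min (c - m) 0\<close>,
  antitone in the old minimum \<open>m\<close>, and the larger set has the smaller \<open>m\<close>.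
  Nonemptiness of \<open>A\<close> keeps \<open>Min\<close> meaningful.\<close>

lemma Min_image_insert_diff_mono:
  fixes q :: "'a \<Rightarrow> real"
  assumes "finite B" and "A \<subseteq> B" and "A \<noteq> {}"
  shows "Min (q ` insert x A) - Min (q ` A) \<le> Min (q ` insert x B) - Min (q ` B)"
proof -
  have insert: "Min (q ` insert x C) = min (q x) (Min (q ` C))" if "finite C" "C \<noteq> {}" for C
    using that by simp
  have "finite A" and "B \<noteq> {}"
    using assms finite_subset by auto
  moreover have "Min (q ` B) \<le> Min (q ` A)"
    using assms by (intro Min_antimono) auto
  then have "min (q x) (Min (q ` A)) - Min (q ` A) \<le> min (q x) (Min (q ` B)) - Min (q ` B)"
    by linarith
  ultimately show ?thesis
    using assms by (simp add: insert del: image_insert)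
qed

theorem mainTheorem2:
  fixes X R :: "'a set" and d :: "'a \<Rightarrow> 'a \<Rightarrow> real" and L :: "'a \<Rightarrow> real" and \<rho> :: real
  assumes "finite X" and "finite R" and "R \<noteq> {}" and "0 \<le> \<rho>" and "\<rho> \<le> 1"
  shows "submodular_on X (\<lambda>S. - selection_cost (pair_cost \<rho> d L) X R S)"
  unfolding submodular_on_def
proof (intro allI impI)
  fix S T x
  assume *: "S \<subseteq> T \<and> T \<subseteq> X \<and> x \<in> X \<and> x \<notin> S \<and> x \<notin> T"
  let ?Q = "pair_cost \<rho> d L"
  have fin: "finite T" "finite S"
    using * assms(1) by (auto intro: finite_subset)
  \<comment> \<open>The lemma is applied to \<open>R \<union> S\<close> and
    \<open>R \<union> T\<close>, which are nonempty thanks to \<open>R\<close> even when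
    \<open>S\<close> is empty.\<close>
  have "(\<Sum>i\<in>X. Min (?Q i ` insert x (R \<union> S)) - Min (?Q i ` (R \<union> S)))
      \<le> (\<Sum>i\<in>X. Min (?Q i ` insert x (R \<union> T)) - Min (?Q i ` (R \<union> T)))"
    using * fin assms by (intro sum_mono Min_image_insert_diff_mono) auto
  then have "selection_cost ?Q X R (S \<union> {x}) - selection_cost ?Q X R S
      \<le> selection_cost ?Q X R (T \<union> {x}) - selection_cost ?Q X R T"
    using fin assms by (simp add: selection_cost_eq_sum_Min sum_subtractf del: image_insert)
  then show "- selection_cost ?Q X R (S \<union> {x}) - - selection_cost ?Q X R S
      \<ge> - selection_cost ?Q X R (T \<union> {x}) - - selection_cost ?Q X R T"
    by simp
qed

end
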